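(* Let $n\ge 1$ and let $x_1,\dots,x_n\in\mathbb{R}^n$ be linearly independent unit vectors. Let $X$ be the real $n\times n$ matrix whose $j$-th row is $x_j$, and let $V_1,\dots,V_n$ denote the (Euclidean) lengths of the column vectors of the matrix $(XX^{\ast})^{-1/2}$. Then $$\max_{\|y\|=1}\prod_{j=1}^{n}|(Xy)_j|\ \ge\ \frac{1}{V_1\cdots V_n}\cdot n^{-n/2},$$ where the maximum is over unit vectors $y\in\mathbb{R}^n$.
   Context: $\mathbb{R}^n$ carries the standard inner product $\langle\cdot,\cdot\rangle$ and Euclidean norm $\|\cdot\|$. $X^{\ast}$ is the transpose of $X$, so $XX^{\ast}=[\langle x_i,x_j\rangle]_{i,j}$ is the Gram matrix of $x_1,\dots,x_n$, and $(Xy)_j=\langle x_j,y\rangle$. $(XX^{\ast})^{1/2}$ is the positive semidefinite self-adjoint square root of $XX^{\ast}$, and $(XX^{\ast})^{-1/2}$ is its inverse (which exists because of linear independence). *)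

theory Defs
  imports "HOL-Analysis.Analysis"
begin

definition psd_matrix :: "real ^ 'n ^ 'n \<Rightarrow> bool" where
  "psd_matrix A \<longleftrightarrow> transpose A = A \<and> (\<forall>v. 0 \<le> v \<bullet> (A *v v))"

text \<open>Only meaningful for positive semidefinite \<open>A\<close>, where exactly one such \<open>B\<close> exists.\<close>

definition psd_sqrt :: "real ^ 'n ^ 'n \<Rightarrow> real ^ 'n ^ 'n" where
  "psd_sqrt A = (THE B. psd_matrix B \<and> B ** B = A)"

end

theory Submission imports Defs begin

text \<open>
  The matrix \<open>(XX\<^sup>*)\<^sup>-\<^sup>1\<^sup>/\<^sup>2\<close> enters only through its column lengths, and these are the column
  lengths of \<open>X\<^sup>-\<^sup>1\<close>: by polar decomposition there is an orthogonal \<open>Q\<close> with \<open>XQ\<close> positive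
  semidefinite, so \<open>XQ\<close> is the square root of \<open>XX\<^sup>*\<close>, and its inverse \<open>Q\<^sup>*X\<^sup>-\<^sup>1\<close> has columns that are
  rotated columns of \<open>X\<^sup>-\<^sup>1\<close> (\<open>norm_column_inverse_sqrt_gram\<close>).

  Let \<open>q\<^sub>j\<close> be the columns of \<open>X\<^sup>-\<^sup>1\<close>, so that \<open>X q\<^sub>j\<close> is the \<open>j\<close>-th basis vector and
  \<open>V\<^sub>j = \<parallel>q\<^sub>j\<parallel>\<close>. The vector \<open>w = \<Sum>\<^sub>j \<epsilon>\<^sub>j q\<^sub>j / V\<^sub>j\<close> with signs \<open>\<epsilon>\<^sub>j\<close> has
  \<open>\<bar>(Xw)\<^sub>j\<bar> = 1 / V\<^sub>j\<close> whatever the signs are. It is a signed sum of \<open>n\<close> unit vectors, and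
  for a suitable choice of signs its length is at most \<open>\<surd>n\<close> (\<open>signed_sum_norm_le\<close>). Dividing \<open>w\<close> by
  its length gives a unit vector at which the product is at least the claimed bound, and the
  maximum, which exists because the sphere is compact, is no smaller.
\<close>

section \<open>Signed sums of vectors\<close>

text \<open>
  Adding the vectors one at a time, each with the sign that makes an angle of at least \<open>90\<close>
  degrees with the sum so far, never makes the cross term positive.
\<close>

lemma signed_sum_norm_le:
  fixes u :: "'i \<Rightarrow> 'a::real_inner"
  assumes "finite S"
  shows "\<exists>e::'i \<Rightarrow> real. (\<forall>i. \<bar>e i\<bar> = 1) \<and> (norm (\<Sum>i\<in>S. e i *\<^sub>R u i))\<^sup>2 \<le> (\<Sum>i\<in>S. (norm (u i))\<^sup>2)"
  using assms
proof (induction S)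
  case empty
  show ?case by (rule exI[of _ "\<lambda>_. 1"]) simp
next
  case (insert k S)
  then obtain e :: "'i \<Rightarrow> real" where e: "\<And>i. \<bar>e i\<bar> = 1"
    and le: "(norm (\<Sum>i\<in>S. e i *\<^sub>R u i))\<^sup>2 \<le> (\<Sum>i\<in>S. (norm (u i))\<^sup>2)"
    by blast
  define w where "w = (\<Sum>i\<in>S. e i *\<^sub>R u i)"
  define t :: real where "t = (if u k \<bullet> w \<le> 0 then 1 else - 1)"
  have t: "\<bar>t\<bar> = 1" "t * (u k \<bullet> w) \<le> 0" "t * t = 1" by (auto simp: t_def)
  define e' where "e' = e(k := t)"
  have "(\<Sum>i\<in>insert k S. e' i *\<^sub>R u i) = t *\<^sub>R u k + w"
  proof -
    have "(\<Sum>i\<in>S. e' i *\<^sub>R u i) = w"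
      unfolding w_def e'_def using insert.hyps by (intro sum.cong) auto
    then show ?thesis using insert.hyps by (simp add: e'_def)
  qed
  moreover have "(norm (t *\<^sub>R u k + w))\<^sup>2 = (norm (u k))\<^sup>2 + 2 * (t * (u k \<bullet> w)) + (norm w)\<^sup>2"
  proof -
    have "(norm (t *\<^sub>R u k + w))\<^sup>2 = (t * t) * (u k \<bullet> u k) + 2 * (t * (u k \<bullet> w)) + w \<bullet> w"
      by (simp add: power2_norm_eq_inner inner_simps inner_commute[of w "u k"] distrib_left)
    then show ?thesis by (simp add: t(3) power2_norm_eq_inner)
  qed
  ultimately have "(norm (\<Sum>i\<in>insert k S. e' i *\<^sub>R u i))\<^sup>2 \<le> (\<Sum>i\<in>insert k S. (norm (u i))\<^sup>2)"
    using insert.hyps t(2) le by (simp add: w_def)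
  moreover have "\<forall>i. \<bar>e' i\<bar> = 1" using e t by (simp add: e'_def)
  ultimately show ?case by blast
qed

section \<open>Polar decomposition\<close>

lemma inner_matrix_vector_transpose:
  fixes A :: "real ^ 'n ^ 'm"
  shows "x \<bullet> (A *v y) = (transpose A *v x) \<bullet> y"
  by (metis dot_lmul_matrix transpose_matrix_vector)

lemma matrix_mult_diff:
  fixes A B :: "real ^ 'n ^ 'n"
  shows "M ** (A - B) = M ** A - M ** B" "(A - B) ** M = A ** M - B ** M"
  by (simp_all add: matrix_matrix_mult_def vec_eq_iff sum_subtractf algebra_simps)

lemma matrix_mult_add_rdistrib:
  fixes A B :: "real ^ 'n ^ 'n"
  shows "(A + B) ** M = A ** M + B ** M"
  by (simp add: matrix_matrix_mult_def vec_eq_iff sum.distrib algebra_simps)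

text \<open>
  First-order condition at a minimum, in the form in which both variational arguments below
  use it.
\<close>

lemma linear_coefficient_zero:
  fixes a b :: real
  assumes nonneg: "\<And>s. 0 \<le> s * a + s\<^sup>2 * b"
  shows "a = 0"
proof (rule ccontr)
  assume "a \<noteq> 0"
  \<comment> \<open>For \<open>r > b\<close> the step \<open>s = - a / r\<close> is short enough that the linear term outweighs the
    quadratic one.\<close>
  define r where "r = \<bar>b\<bar> + 1"
  have r: "0 < r" "b < r" by (auto simp: r_def)
  have "(- a / r) * a + (- a / r)\<^sup>2 * b = (a / r)\<^sup>2 * (b - r)"
    using r by (simp add: field_simps power2_eq_square)
  also have "\<dots> < 0"
    using \<open>a \<noteq> 0\<close> r by (intro mult_pos_neg) auto
  finally show False using nonneg[of "- a / r"] by linarith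
qed

definition outer :: "real ^ 'n \<Rightarrow> real ^ 'n \<Rightarrow> real ^ 'n ^ 'n" where
  "outer a b = (\<chi> i j. a $ i * b $ j)"

text \<open>
  Reflection in the hyperplane orthogonal to \<open>a\<close>. For \<open>a = 0\<close> division by zero makes it the
  identity, so it is orthogonal for every \<open>a\<close>.
\<close>

definition householder :: "real ^ 'n \<Rightarrow> real ^ 'n ^ 'n" where
  "householder a = mat 1 - (2 / (a \<bullet> a)) *\<^sub>R outer a a"

lemma outer_mult_vec: "outer a b *v v = (b \<bullet> v) *\<^sub>R a"
  by (simp add: outer_def matrix_vector_mult_def vec_eq_iff inner_vec_def sum_distrib_left ac_simps)

lemma trace_mult_outer: "trace (M ** outer a b) = b \<bullet> (M *v a)"
  by (simp add: outer_def matrix_matrix_mult_def matrix_vector_mult_def trace_def inner_vec_def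
      sum_distrib_left ac_simps)

lemma householder_mult_vec: "householder a *v v = v - (2 * (a \<bullet> v) / (a \<bullet> a)) *\<^sub>R a"
  by (simp add: householder_def matrix_vector_mult_diff_rdistrib outer_mult_vec
      flip: scaleR_matrix_vector_assoc)

lemma orthogonal_matrix_householder: "orthogonal_matrix (householder a)"
proof -
  have sym: "transpose (householder a) = householder a"
    by (simp add: householder_def outer_def transpose_def mat_def vec_eq_iff ac_simps)
  have "householder a *v (householder a *v v) = v" for v
    by (cases "a = 0") (simp_all add: householder_mult_vec inner_simps field_simps flip: scaleR_add_left)
  then have "householder a ** householder a = mat 1"
    by (simp add: matrix_eq flip: matrix_vector_mul_assoc)
  then show ?thesis by (simp add: orthogonal_matrix sym)
qed

lemma trace_scaleR: "trace (c *\<^sub>R A) = c * trace (A :: real ^ 'n ^ 'n)"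
  by (simp add: trace_def sum_distrib_left)

lemma trace_mult_householder:
  "trace (M ** householder a) = trace M - 2 / (a \<bullet> a) * (a \<bullet> (M *v a))"
  by (simp add: householder_def matrix_mult_diff trace_sub trace_scaleR trace_mult_outer matrix_scalar_ac
      flip: scalar_matrix_assoc)

text \<open>
  Multiplying by one reflection changes the trace by a negative multiple of \<open>a \<bullet> M a\<close>, which
  gives nonnegativity. Symmetry needs perturbations close to the identity; the product of the
  reflections along two nearby vectors \<open>v + s w\<close> and \<open>v\<close> is such a rotation by a small angle,
  and the derivative of the trace at \<open>s = 0\<close> is a nonzero multiple of
  \<open>w \<bullet> M v - v \<bullet> M w\<close>.
\<close>

lemma psd_of_trace_maximal:
  fixes M :: "real ^ 'n ^ 'n"
  assumes max: "\<And>R. orthogonal_matrix R \<Longrightarrow> trace (M ** R) \<le> trace M"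
  shows "psd_matrix M"
proof -
  have nonneg: "0 \<le> a \<bullet> (M *v a)" for a
  proof (cases "a = 0")
    case False
    then have "0 < a \<bullet> a" by simp
    then show ?thesis
      using max[OF orthogonal_matrix_householder[of a]]
      by (auto simp: trace_mult_householder zero_le_divide_iff simp del: inner_gt_zero_iff)
  qed simp
  \<comment> \<open>Maximality against a product of two reflections, cleared of denominators.\<close>
  have two: "2 * (a \<bullet> b) * (b \<bullet> (M *v a)) \<le> (b \<bullet> b) * (a \<bullet> (M *v a)) + (a \<bullet> a) * (b \<bullet> (M *v b))"
    for a b
  proof (cases "a = 0 \<or> b = 0")
    case False
    then have pos: "0 < a \<bullet> a" "0 < b \<bullet> b" by simp_all
    have "trace (M ** (householder a ** householder b)) \<le> trace M"
      by (intro max orthogonal_matrix_mul orthogonal_matrix_householder)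
    moreover have "trace (M ** (householder a ** householder b))
      = trace M - 2 / (a \<bullet> a) * (a \<bullet> (M *v a)) - 2 / (b \<bullet> b) * (b \<bullet> (M *v b))
        + 4 / ((a \<bullet> a) * (b \<bullet> b)) * (a \<bullet> b) * (b \<bullet> (M *v a))"
    proof -
      have "b \<bullet> ((M ** householder a) *v b) = b \<bullet> (M *v b) - 2 * (a \<bullet> b) / (a \<bullet> a) * (b \<bullet> (M *v a))"
        by (simp add: householder_mult_vec matrix_vector_mult_diff_distrib matrix_vector_mult_scaleR
            inner_simps flip: matrix_vector_mul_assoc)
      then show ?thesis
        unfolding matrix_mul_assoc trace_mult_householder
        using pos by (simp add: field_simps)
    qed
    ultimately have "0 \<le> 2 / (a \<bullet> a) * (a \<bullet> (M *v a)) + 2 / (b \<bullet> b) * (b \<bullet> (M *v b))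
        - 4 / ((a \<bullet> a) * (b \<bullet> b)) * (a \<bullet> b) * (b \<bullet> (M *v a))" (is "0 \<le> ?d") by simp
    then have "0 \<le> (a \<bullet> a) * (b \<bullet> b) * ?d" using pos by (intro mult_nonneg_nonneg) auto
    also have "\<dots> = 2 * ((b \<bullet> b) * (a \<bullet> (M *v a)) + (a \<bullet> a) * (b \<bullet> (M *v b))
        - 2 * (a \<bullet> b) * (b \<bullet> (M *v a)))"
      using pos by (simp add: field_simps)
    finally show ?thesis by simp
  qed auto
  have sym: "w \<bullet> (M *v v) = v \<bullet> (M *v w)" for v w
  proof (cases "v = 0")
    case False
    \<comment> \<open>Coefficients of \<open>s\<close> and \<open>s\<^sup>2\<close> in the inequality above for \<open>a = v + s w\<close>, \<open>b = v\<close>;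
      the constant terms cancel.\<close>
    define c where "c = (v \<bullet> v) * (w \<bullet> (M *v v) - v \<bullet> (M *v w))"
    define d where "d = (v \<bullet> v) * (w \<bullet> (M *v w)) + (w \<bullet> w) * (v \<bullet> (M *v v))
      - 2 * (v \<bullet> w) * (v \<bullet> (M *v w))"
    have "0 \<le> s * c + s\<^sup>2 * d" for s
    proof -
      let ?a = "v + s *\<^sub>R w"
      have "s * c + s\<^sup>2 * d = (v \<bullet> v) * (?a \<bullet> (M *v ?a)) + (?a \<bullet> ?a) * (v \<bullet> (M *v v))
          - 2 * (?a \<bullet> v) * (v \<bullet> (M *v ?a))"
        unfolding c_def d_def
        by (simp add: inner_simps matrix_vector_right_distrib matrix_vector_mult_scaleR
            inner_commute[of w v] algebra_simps power2_eq_square)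
      also have "\<dots> \<ge> 0" using two[of ?a v] by simp
      finally show ?thesis .
    qed
    then have "c = 0" by (rule linear_coefficient_zero)
    with False show ?thesis by (simp add: c_def)
  qed simp
  have "transpose M *v v = M *v v" for v
  proof (rule vector_eq_rdot[THEN iffD1], rule allI)
    fix w
    show "(transpose M *v v) \<bullet> w = (M *v v) \<bullet> w"
      by (metis inner_matrix_vector_transpose sym inner_commute)
  qed
  then have "transpose M = M" by (simp add: matrix_eq)
  with nonneg show ?thesis by (simp add: psd_matrix_def)
qed

text \<open>
  The orthogonal group is compact, so the trace of \<open>X Q\<close> attains a maximum on it; the
  orthogonal factor is any maximizer. This avoids diagonalizing \<open>X X\<^sup>*\<close>.
\<close>

lemma polar_decomposition:
  fixes X :: "real ^ 'n ^ 'n"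
  obtains Q where "orthogonal_matrix Q" "psd_matrix (X ** Q)"
proof -
  let ?O = "{Q :: real ^ 'n ^ 'n. orthogonal_matrix Q}"
  have mult_cont: "continuous_on UNIV (\<lambda>Q. A Q ** B Q)"
    if "continuous_on UNIV A" "continuous_on UNIV B" for A B :: "real ^ 'n ^ 'n \<Rightarrow> real ^ 'n ^ 'n"
    unfolding matrix_matrix_mult_def using that by (intro continuous_intros)
  have "continuous_on UNIV (\<lambda>Q :: real ^ 'n ^ 'n. transpose Q)"
    unfolding transpose_def by (intro continuous_intros)
  then have "closed {Q :: real ^ 'n ^ 'n. transpose Q ** Q = mat 1}"
    by (intro closed_Collect_eq mult_cont continuous_intros)
  then have "closed ?O" by (simp add: orthogonal_matrix)
  moreover have "bounded ?O"
  proof -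
    have "norm Q \<le> real CARD('n)" if "orthogonal_matrix Q" for Q :: "real ^ 'n ^ 'n"
    proof -
      have "norm (Q $ i) = 1" for i
        using that by (auto simp: orthogonal_matrix_orthonormal_rows row_def)
      then have "(\<Sum>i\<in>UNIV. norm (Q $ i)) = real CARD('n)" by simp
      moreover have "norm Q \<le> (\<Sum>i\<in>UNIV. norm (Q $ i))"
        unfolding norm_vec_def[of Q] by (rule L2_set_le_sum) simp
      ultimately show ?thesis by simp
    qed
    then show ?thesis by (auto simp: bounded_iff)
  qed
  ultimately have "compact ?O" by (simp add: compact_eq_bounded_closed)
  moreover have "?O \<noteq> {}" using orthogonal_matrix_id by blast
  moreover have "continuous_on UNIV (\<lambda>Q :: real ^ 'n ^ 'n. trace (X ** Q))"
  proof -
    have "continuous_on UNIV (\<lambda>Q :: real ^ 'n ^ 'n. X ** Q)"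
      by (intro mult_cont continuous_intros)
    then show ?thesis unfolding trace_def by (intro continuous_intros)
  qed
  then have "continuous_on ?O (\<lambda>Q. trace (X ** Q))"
    by (rule continuous_on_subset) simp
  ultimately obtain Q where Q: "orthogonal_matrix Q"
    and max: "\<And>R. orthogonal_matrix R \<Longrightarrow> trace (X ** R) \<le> trace (X ** Q)"
    using continuous_attains_sup[of ?O "\<lambda>Q. trace (X ** Q)"] by blast
  have "psd_matrix (X ** Q)"
    by (rule psd_of_trace_maximal)
      (simp add: max orthogonal_matrix_mul Q flip: matrix_mul_assoc)
  with Q show thesis by (rule that)
qed

section \<open>Uniqueness of the square root\<close>

text \<open>
  Such a \<open>v\<close> minimizes the quadratic form of \<open>B\<close>, so the derivative \<open>2 B v\<close> of the form vanishes
  there; it suffices to test it in the direction \<open>B v\<close> itself.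
\<close>

lemma psd_kernel:
  assumes "psd_matrix B" "v \<bullet> (B *v v) = 0"
  shows "B *v v = 0"
proof -
  define w where "w = B *v v"
  have vw: "v \<bullet> (B *v w) = w \<bullet> w"
    using assms(1) by (simp add: w_def psd_matrix_def inner_matrix_vector_transpose[of v])
  have "0 \<le> s * (2 * (w \<bullet> w)) + s\<^sup>2 * (w \<bullet> (B *v w))" for s
  proof -
    have "0 \<le> (v + s *\<^sub>R w) \<bullet> (B *v (v + s *\<^sub>R w))"
      using assms(1) by (simp add: psd_matrix_def)
    also have "\<dots> = s * (2 * (w \<bullet> w)) + s\<^sup>2 * (w \<bullet> (B *v w))"
      using assms(2) vw
      by (simp add: inner_simps matrix_vector_right_distrib matrix_vector_mult_scaleR
          algebra_simps power2_eq_square flip: w_def)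
    finally show ?thesis .
  qed
  then have "2 * (w \<bullet> w) = 0" by (rule linear_coefficient_zero)
  then show ?thesis by (simp add: w_def)
qed

lemma trace_congruence:
  fixes D :: "real ^ 'n ^ 'n"
  shows "trace (transpose D ** B ** D) = (\<Sum>j\<in>UNIV. column j D \<bullet> (B *v column j D))"
proof -
  have "(transpose D ** B ** D) $ j $ j = column j D \<bullet> (B *v column j D)" for j
  proof -
    have "column j (transpose D ** B ** D) = transpose D *v (B *v column j D)"
      by (simp add: matrix_vector_mul_assoc matrix_mul_assoc flip: matrix_vector_mult_basis)
    then have "(transpose D ** B ** D) $ j $ j = (transpose D *v (B *v column j D)) $ j"
      by (metis column_def vec_lambda_beta)
    also have "\<dots> = column j D \<bullet> (B *v column j D)"
      by (simp add: matrix_vector_mul_component transpose_def column_def del: transpose_matrix_vector)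
    finally show ?thesis .
  qed
  then show ?thesis by (simp add: trace_def)
qed

text \<open>
  With \<open>D = B - C\<close>, equality of the squares reads \<open>B D + D C = 0\<close>. Multiplying by \<open>D\<close> and taking
  the trace gives \<open>tr (D B D) + tr (D C D) = 0\<close>, a sum of values of the two quadratic forms at
  the columns of \<open>D\<close>. All of them vanish, so both \<open>B\<close> and \<open>C\<close>, and with them \<open>D\<close>, annihilate
  every column of \<open>D\<close>. Thus \<open>D\<^sup>2 = 0\<close>, and \<open>D = 0\<close> because \<open>D\<close> is symmetric.
\<close>

lemma psd_sqrt_unique:
  fixes B C :: "real ^ 'n ^ 'n"
  assumes B: "psd_matrix B" and C: "psd_matrix C" and eq: "B ** B = C ** C"
  shows "B = C"
proof -
  define D where "D = B - C"
  have D: "transpose D = D"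
    using B C by (simp add: D_def psd_matrix_def transpose_def vec_eq_iff)
  have "B ** D + D ** C = 0"
    using eq by (simp add: D_def matrix_mult_diff)
  then have "trace ((B ** D + D ** C) ** D) = 0" by (simp add: trace_def)
  moreover have "trace ((B ** D + D ** C) ** D) = trace (D ** B ** D) + trace (D ** C ** D)"
    using trace_mul_sym[of "B ** D" D]
    by (simp add: matrix_mult_add_rdistrib trace_add matrix_mul_assoc)
  moreover have "trace (D ** A ** D) = (\<Sum>j\<in>UNIV. column j D \<bullet> (A *v column j D))" for A
    using trace_congruence[of D A] D by simp
  ultimately have sum0: "(\<Sum>j\<in>UNIV. column j D \<bullet> (B *v column j D) + column j D \<bullet> (C *v column j D)) = 0"
    by (simp add: sum.distrib)
  have nonneg: "0 \<le> v \<bullet> (B *v v)" "0 \<le> v \<bullet> (C *v v)" for v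
    using B C by (simp_all add: psd_matrix_def)
  have "column j D = 0" for j
  proof -
    let ?v = "column j D"
    have "?v \<bullet> (B *v ?v) + ?v \<bullet> (C *v ?v) = 0"
      using sum0 by (subst (asm) sum_nonneg_eq_0_iff) (auto intro: add_nonneg_nonneg nonneg)
    then have "?v \<bullet> (B *v ?v) = 0" "?v \<bullet> (C *v ?v) = 0"
      using nonneg[of ?v] by linarith+
    then have "D *v ?v = 0"
      using psd_kernel[OF B, of ?v] psd_kernel[OF C, of ?v]
      by (simp add: D_def matrix_vector_mult_diff_rdistrib)
    moreover have "?v \<bullet> ?v = axis j 1 \<bullet> (D *v ?v)"
      by (metis D inner_matrix_vector_transpose matrix_vector_mult_basis)
    ultimately show ?thesis by simp
  qed
  then have "D = 0" by (simp add: column_def vec_eq_iff)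
  then show ?thesis by (simp add: D_def)
qed

lemma psd_sqrt_gram:
  fixes X Q :: "real ^ 'n ^ 'n"
  assumes Q: "orthogonal_matrix Q" and psd: "psd_matrix (X ** Q)"
  shows "psd_sqrt (X ** transpose X) = X ** Q"
proof -
  have "(X ** Q) ** (X ** Q) = (X ** Q) ** transpose (X ** Q)"
    using psd by (simp add: psd_matrix_def)
  also have "\<dots> = X ** (Q ** transpose Q) ** transpose X"
    by (simp add: matrix_transpose_mul matrix_mul_assoc)
  also have "\<dots> = X ** transpose X"
    using Q by (simp add: orthogonal_matrix_def)
  finally have root: "(X ** Q) ** (X ** Q) = X ** transpose X" .
  have "B = X ** Q" if "psd_matrix B" "B ** B = X ** transpose X" for B
    using psd_sqrt_unique[OF that(1) psd] that(2) root by simp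
  with psd root show ?thesis
    unfolding psd_sqrt_def by (intro the_equality) blast+
qed

lemma matrix_inv_eqI:
  fixes A B :: "real ^ 'n ^ 'n"
  assumes "A ** B = mat 1"
  shows "matrix_inv A = B"
proof -
  have BA: "B ** A = mat 1" using assms by (simp add: matrix_left_right_inverse)
  show ?thesis
    unfolding matrix_inv_def
  proof (rule some_equality)
    fix C assume "A ** C = mat 1 \<and> C ** A = mat 1"
    then show "C = B"
      by (metis BA matrix_mul_assoc matrix_mul_lid matrix_mul_rid)
  qed (use assms BA in simp)
qed

text \<open>
  The square root is \<open>X Q\<close> with \<open>Q\<close> orthogonal, so its inverse is \<open>Q\<^sup>* Y\<close>, and \<open>Q\<^sup>*\<close> preserves lengths.
\<close>

lemma norm_column_inverse_sqrt_gram: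
  fixes X Y :: "real ^ 'n ^ 'n"
  assumes XY: "X ** Y = mat 1"
  shows "norm (column j (matrix_inv (psd_sqrt (X ** transpose X)))) = norm (column j Y)"
proof -
  obtain Q where Q: "orthogonal_matrix Q" and psd: "psd_matrix (X ** Q)"
    by (rule polar_decomposition)
  have "(X ** Q) ** (transpose Q ** Y) = X ** (Q ** transpose Q) ** Y"
    by (simp add: matrix_mul_assoc)
  also have "\<dots> = mat 1" using Q XY by (simp add: orthogonal_matrix_def)
  finally have "matrix_inv (psd_sqrt (X ** transpose X)) = transpose Q ** Y"
    by (simp add: psd_sqrt_gram[OF Q psd] matrix_inv_eqI)
  moreover have "column j (transpose Q ** Y) = transpose Q *v column j Y"
    by (simp add: matrix_vector_mul_assoc flip: matrix_vector_mult_basis)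
  moreover have "orthogonal_transformation ((*v) (transpose Q))"
    using Q by (simp add: orthogonal_transformation_matrix del: transpose_matrix_vector)
  ultimately show ?thesis
    using orthogonal_transformation_norm[of "(*v) (transpose Q)" "column j Y"] by simp
qed

section \<open>The lower bound\<close>

text \<open>
  The vector is a short signed sum of the normalized columns of \<open>Y\<close>: the signs decide its length
  but do not affect the absolute values of the coordinates of its image under \<open>X\<close>.
\<close>

lemma exists_unit_vector_large_product:
  fixes X Y :: "real ^ 'n ^ 'n"
  assumes XY: "X ** Y = mat 1"
  shows "\<exists>z. norm z = 1 \<and> (\<Prod>j\<in>UNIV. \<bar>(X *v z) $ j\<bar>)
    \<ge> 1 / (\<Prod>j\<in>UNIV. norm (column j Y)) * real CARD('n) powr (- (real CARD('n) / 2))"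
proof -
  define n where "n = CARD('n)"
  define q where "q j = column j Y" for j
  have Xq: "X *v q j = axis j 1" for j
    unfolding q_def matrix_vector_mult_basis[symmetric] by (simp add: matrix_vector_mul_assoc XY)
  have q: "0 < norm (q j)" for j
    using Xq[of j] by (auto simp: axis_eq_0_iff)
  obtain e :: "'n \<Rightarrow> real" where e: "\<And>j. \<bar>e j\<bar> = 1"
    and small: "(norm (\<Sum>j\<in>UNIV. e j *\<^sub>R sgn (q j)))\<^sup>2 \<le> (\<Sum>j\<in>(UNIV::'n set). (norm (sgn (q j)))\<^sup>2)"
    using signed_sum_norm_le[of UNIV "\<lambda>j. sgn (q j)"] by auto
  define w where "w = (\<Sum>j\<in>UNIV. e j *\<^sub>R sgn (q j))"
  have "(\<Sum>j\<in>(UNIV::'n set). (norm (sgn (q j)))\<^sup>2) = real n"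
    using q by (simp add: norm_sgn n_def)
  with small have "(norm w)\<^sup>2 \<le> real n" by (simp add: w_def)
  then have norm_w: "norm w \<le> sqrt (real n)" by (rule real_le_rsqrt)
  have "X *v w = (\<Sum>j\<in>UNIV. (e j / norm (q j)) *\<^sub>R axis j 1)"
    by (simp add: w_def linear_sum[OF matrix_vector_mul_linear] matrix_vector_mult_scaleR
        sgn_div_norm Xq o_def divide_inverse)
  then have Xw: "(X *v w) $ i = e i / norm (q i)" for i
    by (simp add: axis_def if_distrib cong: if_cong)
  have "w \<noteq> 0"
  proof
    assume "w = 0"
    then have "e i / norm (q i) = 0" for i using Xw[of i] by simp
    with e[of undefined] q[of undefined] show False by (metis abs_zero divide_eq_0_iff less_irrefl zero_neq_one)
  qed
  then have w: "0 < norm w" by simp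
  have "(\<Prod>j\<in>UNIV. \<bar>(X *v sgn w) $ j\<bar>) = (\<Prod>j\<in>(UNIV::'n set). (1 / norm (q j)) * (1 / norm w))"
    by (intro prod.cong) (simp_all add: sgn_div_norm matrix_vector_mult_scaleR Xw abs_mult e divide_inverse)
  also have "\<dots> = 1 / (\<Prod>j\<in>UNIV. norm (q j)) * (1 / norm w ^ n)"
    by (simp add: prod.distrib prod_dividef power_divide n_def)
  also have "\<dots> \<ge> 1 / (\<Prod>j\<in>UNIV. norm (q j)) * real n powr (- (real n / 2))"
  proof (intro mult_left_mono)
    have n: "0 < n" by (simp add: n_def)
    have "norm w ^ n \<le> sqrt (real n) ^ n" using norm_w by (intro power_mono) auto
    also have "\<dots> = real n powr (real n / 2)"
      using n by (simp add: powr_half_sqrt[symmetric] powr_powr flip: powr_realpow)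
    finally have "1 / real n powr (real n / 2) \<le> 1 / norm w ^ n"
      using w n by (intro divide_left_mono) auto
    then show "real n powr (- (real n / 2)) \<le> 1 / norm w ^ n"
      by (simp add: powr_minus_divide)
  qed (simp add: prod_nonneg)
  finally have "(\<Prod>j\<in>UNIV. \<bar>(X *v sgn w) $ j\<bar>)
    \<ge> 1 / (\<Prod>j\<in>UNIV. norm (q j)) * real n powr (- (real n / 2))" .
  moreover have "norm (sgn w) = 1" using \<open>w \<noteq> 0\<close> by (simp add: norm_sgn)
  ultimately show ?thesis unfolding n_def q_def by blast
qed

lemma right_inverse_of_independent_rows:
  fixes x :: "'n::finite \<Rightarrow> real ^ 'n"
  assumes "inj x" "independent (range x)"
  obtains Y where "(\<chi> j. x j) ** Y = mat 1"
proof -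
  have "\<forall>i. c i = 0" if "(\<Sum>i\<in>UNIV. c i *\<^sub>R x i) = 0" for c
  proof
    fix i
    \<comment> \<open>Independence is about the set of rows; injectivity carries it over to the indexed family.\<close>
    have "(\<Sum>v\<in>range x. c (inv x v) *\<^sub>R v) = (\<Sum>i\<in>UNIV. c i *\<^sub>R x i)"
      using assms(1) by (simp add: sum.reindex)
    then have "(\<Sum>v\<in>range x. c (inv x v) *\<^sub>R v) = 0" using that by simp
    then have "c (inv x (x i)) = 0"
      using independentD[OF assms(2), of "range x" "\<lambda>v. c (inv x v)" "x i"] by auto
    then show "c i = 0" using assms(1) by simp
  qed
  then have "\<forall>c. (\<Sum>i\<in>UNIV. c i *s row i (\<chi> j. x j)) = 0 \<longrightarrow> (\<forall>i. c i = 0)"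
    by (simp add: row_def scalar_mult_eq_scaleR)
  then show thesis
    using matrix_right_invertible_independent_rows that by blast
qed

theorem theorem2p2:
  fixes x :: "'n::finite \<Rightarrow> real ^ 'n"
    and X :: "real ^ 'n ^ 'n"
    and V :: "'n \<Rightarrow> real"
  assumes unit: "\<forall>j. norm (x j) = 1"
    and lin_indep: "inj x" "independent (range x)"
    and X: "X = (\<chi> j. x j)"
    and V: "\<forall>j. V j = norm (column j (matrix_inv (psd_sqrt (X ** transpose X))))"
  shows "\<exists>y. norm y = 1
    \<and> (\<forall>z. norm z = 1 \<longrightarrow> (\<Prod>j\<in>UNIV. \<bar>(X *v z) $ j\<bar>) \<le> (\<Prod>j\<in>UNIV. \<bar>(X *v y) $ j\<bar>))
    \<and> (\<Prod>j\<in>UNIV. \<bar>(X *v y) $ j\<bar>)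
        \<ge> 1 / (\<Prod>j\<in>UNIV. V j) * real CARD('n) powr (- (real CARD('n) / 2))"
proof -
  obtain Y where XY: "X ** Y = mat 1"
    using right_inverse_of_independent_rows[OF lin_indep] X by blast
  have VY: "V j = norm (column j Y)" for j
    using V norm_column_inverse_sqrt_gram[OF XY] by simp
  obtain z0 where z0: "norm z0 = 1" "(\<Prod>j\<in>UNIV. \<bar>(X *v z0) $ j\<bar>)
      \<ge> 1 / (\<Prod>j\<in>UNIV. V j) * real CARD('n) powr (- (real CARD('n) / 2))"
    using exists_unit_vector_large_product[OF XY] unfolding VY by blast
  let ?f = "\<lambda>z. \<Prod>j\<in>UNIV. \<bar>(X *v z) $ j\<bar>"
  have "continuous_on (sphere 0 1) ?f"
    by (intro continuous_intros linear_continuous_on matrix_vector_mul_bounded_linear)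
  moreover have "sphere 0 1 \<noteq> ({} :: (real ^ 'n) set)" using z0(1) by auto
  ultimately have "\<exists>y\<in>sphere 0 1. \<forall>z\<in>sphere 0 1. ?f z \<le> ?f y"
    by (intro continuous_attains_sup compact_sphere)
  then obtain y where y: "norm y = 1" and max: "\<And>z. norm z = 1 \<Longrightarrow> ?f z \<le> ?f y"
    by (metis mem_sphere_0)
  show ?thesis
  proof (intro exI[of _ y] conjI allI impI)
    show "norm y = 1" by (rule y)
    show "?f z \<le> ?f y" if "norm z = 1" for z using that by (rule max)
    show "1 / (\<Prod>j\<in>UNIV. V j) * real CARD('n) powr (- (real CARD('n) / 2)) \<le> ?f y"
      using z0(2) max[OF z0(1)] by (rule order_trans)
  qed
qed

end
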